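(* Let $L$ be a diassociative algebra with center $Z(L)$. If $Z(L)\subseteq Z^*(L)$, then $\omega(Z(E))=Z(L)$ for every stem extension $0\to\ker\omega\to E\xrightarrow{\omega}L\to 0$.
   Context: A diassociative algebra over a field $\mathbb{F}$ is an $\mathbb{F}$-vector space with two associative bilinear products $\dashv,\vdash$ satisfying $x\dashv(y\dashv z)=x\dashv(y\vdash z)$, $(x\vdash y)\dashv z=x\vdash(y\dashv z)$, $(x\dashv y)\vdash z=(x\vdash y)\vdash z$ for all $x,y,z$. $K'$ is the span of all products $x\dashv y$ and $x\vdash y$ in $K$; $Z(K)$ is the set of $z\in K$ with $z\dashv x=x\dashv z=z\vdash x=x\vdash z=0$ for all $x\in K$. A central extension of $L$ is a short exact sequence $0\to\ker\omega\to E\xrightarrow{\omega}L\to0$ of diassociative algebras with $\ker\omega\subseteq Z(E)$; it is called stem if in addition $\ker\omega\subseteq E'$. $Z^*(L)$ is the intersection of all images $\omega(Z(E))$ over all central extensions $0\to\ker\omega\to E\xrightarrow{\omega}L\to0$ of $L$. *)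

theory Defs
  imports "HOL-Algebra.Module" "HOL-Algebra.AbelCoset"
begin

(* As for the library's modules, the ring fields "mult" and "one" of the record are not used;
   the two products of a diassociative algebra are separate fields. *)
record ('f, 'a) dialg = "('f, 'a) module" +
  lprod :: "['a, 'a] \<Rightarrow> 'a" (infixl \<open>\<stileturn>\<index>\<close> 70)
  rprod :: "['a, 'a] \<Rightarrow> 'a" (infixl \<open>\<turnstile>\<index>\<close> 70)

definition bilinear_op :: "('f, 'r) ring_scheme \<Rightarrow> ('f, 'a, 'm) module_scheme \<Rightarrow> ('a \<Rightarrow> 'a \<Rightarrow> 'a) \<Rightarrow> bool"
  where "bilinear_op F K p \<longleftrightarrow>
    (\<forall>x\<in>carrier K. \<forall>y\<in>carrier K. p x y \<in> carrier K) \<and>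
    (\<forall>x\<in>carrier K. \<forall>y\<in>carrier K. \<forall>z\<in>carrier K.
       p (x \<oplus>\<^bsub>K\<^esub> y) z = p x z \<oplus>\<^bsub>K\<^esub> p y z \<and>
       p x (y \<oplus>\<^bsub>K\<^esub> z) = p x y \<oplus>\<^bsub>K\<^esub> p x z) \<and>
    (\<forall>c\<in>carrier F. \<forall>x\<in>carrier K. \<forall>y\<in>carrier K.
       p (c \<odot>\<^bsub>K\<^esub> x) y = c \<odot>\<^bsub>K\<^esub> p x y \<and>
       p x (c \<odot>\<^bsub>K\<^esub> y) = c \<odot>\<^bsub>K\<^esub> p x y)"

locale diassociative_algebra = field F + module F K
  for F (structure) and K :: "('f, 'a, 'm) dialg_scheme" (structure) +
  assumes lprod_bilinear: "bilinear_op F K (lprod K)"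
    and rprod_bilinear: "bilinear_op F K (rprod K)"
    and lprod_assoc: "\<lbrakk>x \<in> carrier K; y \<in> carrier K; z \<in> carrier K\<rbrakk> \<Longrightarrow>
      (x \<stileturn>\<^bsub>K\<^esub> y) \<stileturn>\<^bsub>K\<^esub> z = x \<stileturn>\<^bsub>K\<^esub> (y \<stileturn>\<^bsub>K\<^esub> z)"
    and rprod_assoc: "\<lbrakk>x \<in> carrier K; y \<in> carrier K; z \<in> carrier K\<rbrakk> \<Longrightarrow>
      (x \<turnstile>\<^bsub>K\<^esub> y) \<turnstile>\<^bsub>K\<^esub> z = x \<turnstile>\<^bsub>K\<^esub> (y \<turnstile>\<^bsub>K\<^esub> z)"
    and lprod_lprod: "\<lbrakk>x \<in> carrier K; y \<in> carrier K; z \<in> carrier K\<rbrakk> \<Longrightarrow>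
      x \<stileturn>\<^bsub>K\<^esub> (y \<stileturn>\<^bsub>K\<^esub> z) = x \<stileturn>\<^bsub>K\<^esub> (y \<turnstile>\<^bsub>K\<^esub> z)"
    and rprod_lprod: "\<lbrakk>x \<in> carrier K; y \<in> carrier K; z \<in> carrier K\<rbrakk> \<Longrightarrow>
      (x \<turnstile>\<^bsub>K\<^esub> y) \<stileturn>\<^bsub>K\<^esub> z = x \<turnstile>\<^bsub>K\<^esub> (y \<stileturn>\<^bsub>K\<^esub> z)"
    and rprod_rprod: "\<lbrakk>x \<in> carrier K; y \<in> carrier K; z \<in> carrier K\<rbrakk> \<Longrightarrow>
      (x \<stileturn>\<^bsub>K\<^esub> y) \<turnstile>\<^bsub>K\<^esub> z = (x \<turnstile>\<^bsub>K\<^esub> y) \<turnstile>\<^bsub>K\<^esub> z"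

definition lin_span :: "('f, 'r) ring_scheme \<Rightarrow> ('f, 'a, 'm) module_scheme \<Rightarrow> 'a set \<Rightarrow> 'a set"
  where "lin_span F K S =
    {\<Oplus>\<^bsub>K\<^esub>v\<in>A. c v \<odot>\<^bsub>K\<^esub> v | A c. finite A \<and> A \<subseteq> S \<and> c \<in> A \<rightarrow> carrier F}"

definition dialg_derived :: "('f, 'r) ring_scheme \<Rightarrow> ('f, 'a, 'm) dialg_scheme \<Rightarrow> 'a set"
  where "dialg_derived F K = lin_span F K
    ({x \<stileturn>\<^bsub>K\<^esub> y | x y. x \<in> carrier K \<and> y \<in> carrier K} \<union>
     {x \<turnstile>\<^bsub>K\<^esub> y | x y. x \<in> carrier K \<and> y \<in> carrier K})"

definition dialg_center :: "('f, 'a, 'm) dialg_scheme \<Rightarrow> 'a set"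
  where "dialg_center K = {z \<in> carrier K. \<forall>x\<in>carrier K.
    z \<stileturn>\<^bsub>K\<^esub> x = \<zero>\<^bsub>K\<^esub> \<and> x \<stileturn>\<^bsub>K\<^esub> z = \<zero>\<^bsub>K\<^esub> \<and> z \<turnstile>\<^bsub>K\<^esub> x = \<zero>\<^bsub>K\<^esub> \<and> x \<turnstile>\<^bsub>K\<^esub> z = \<zero>\<^bsub>K\<^esub>}"

definition dialg_hom ::
  "('f, 'r) ring_scheme \<Rightarrow> ('f, 'a, 'm) dialg_scheme \<Rightarrow> ('f, 'b, 'n) dialg_scheme \<Rightarrow> ('a \<Rightarrow> 'b) set"
  where "dialg_hom F K L = {h \<in> carrier K \<rightarrow> carrier L.
    (\<forall>x\<in>carrier K. \<forall>y\<in>carrier K.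
       h (x \<oplus>\<^bsub>K\<^esub> y) = h x \<oplus>\<^bsub>L\<^esub> h y \<and>
       h (x \<stileturn>\<^bsub>K\<^esub> y) = h x \<stileturn>\<^bsub>L\<^esub> h y \<and>
       h (x \<turnstile>\<^bsub>K\<^esub> y) = h x \<turnstile>\<^bsub>L\<^esub> h y) \<and>
    (\<forall>c\<in>carrier F. \<forall>x\<in>carrier K. h (c \<odot>\<^bsub>K\<^esub> x) = c \<odot>\<^bsub>L\<^esub> h x)}"

(* For a homomorphism w, exactness of 0 \<rightarrow> ker w \<rightarrow> E \<rightarrow> L \<rightarrow> 0 amounts to w being onto L. *)
definition central_extension ::
  "('f, 'r) ring_scheme \<Rightarrow> ('f, 'e, 'm) dialg_scheme \<Rightarrow> ('e \<Rightarrow> 'a) \<Rightarrow> ('f, 'a, 'n) dialg_scheme \<Rightarrow> bool"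
  where "central_extension F E w L \<longleftrightarrow>
    diassociative_algebra F E \<and> diassociative_algebra F L \<and>
    w \<in> dialg_hom F E L \<and> w ` carrier E = carrier L \<and>
    a_kernel E L w \<subseteq> dialg_center E"

definition stem_extension ::
  "('f, 'r) ring_scheme \<Rightarrow> ('f, 'e, 'm) dialg_scheme \<Rightarrow> ('e \<Rightarrow> 'a) \<Rightarrow> ('f, 'a, 'n) dialg_scheme \<Rightarrow> bool"
  where "stem_extension F E w L \<longleftrightarrow>
    central_extension F E w L \<and> a_kernel E L w \<subseteq> dialg_derived F E"

(* HOL cannot quantify over all types, so E ranges over the algebras whose carrier is a set of
   lists over the type of L. This omits no image w(Z(E)): let E be a central extension with
   carrier in any type. If L = 0, then w(Z(E)) = 0, which the zero algebra also gives. Otherwise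
   let E1 be the subalgebra of E generated by one preimage of each element of L.
   Then E = E1 + ker w with ker w central, so Z(E1) is the intersection of E1 and Z(E),
   E1 is a central extension of L, and w(Z(E1)) = w(Z(E)). Since F embeds into L (as c x0 for a
   fixed nonzero x0), E1 has at most max(card L, aleph_0) elements, hence it is isomorphic to an
   algebra on a set of lists. The family is nonempty: it contains a copy of the identity of L. *)
definition Zstar :: "('f, 'r) ring_scheme \<Rightarrow> ('f, 'a, 'n) dialg_scheme \<Rightarrow> 'a set"
  where "Zstar F L =
    \<Inter>{w ` dialg_center E | (E :: ('f, 'a list) dialg) w. central_extension F E w L}"

end

theory Submission
  imports Defs
begin

text \<open>
  The centre of \<open>E\<close> always maps into the centre of \<open>L\<close>, and the reverse inclusion would be
  the definition of \<open>Zstar\<close> if \<open>E\<close> lived on lists over the type of \<open>L\<close>. A general \<open>E\<close> is replaced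
  by a subalgebra \<open>S\<close> that contains a preimage of every element of \<open>L\<close>. Since \<open>E = S + ker \<omega>\<close> with
  \<open>ker \<omega>\<close> central, an element that is central in \<open>S\<close> is central in \<open>E\<close>. When \<open>L \<noteq> 0\<close> the field
  embeds into \<open>L\<close>, so \<open>S\<close> can be chosen no larger than the set of lists over \<open>L\<close>.
\<close>

section \<open>Closing a set under a bounded family of binary operations\<close>

text \<open>Countably many rounds of adjoining all values of the operations reach the closure. Each
  round is a union over index sets of size at most that of \<open>U\<close>, and so is the union of
  all rounds, so the infinite cardinal of \<open>U\<close> absorbs them. The set \<open>C\<close>
  keeps the closure inside a given carrier.\<close>

lemma bounded_closure_exists:
  includes cardinal_syntax
  fixes Ops :: "('e \<Rightarrow> 'e \<Rightarrow> 'e) set" and X C :: "'e set" and U :: "'c set"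
  assumes U: "infinite U" and X: "|X| \<le>o |U|" and Ops: "|Ops| \<le>o |U|"
    and XC: "X \<subseteq> C" and C: "\<forall>f\<in>Ops. \<forall>x\<in>C. \<forall>y\<in>C. f x y \<in> C"
  shows "\<exists>S. X \<subseteq> S \<and> S \<subseteq> C \<and> |S| \<le>o |U| \<and> (\<forall>f\<in>Ops. \<forall>x\<in>S. \<forall>y\<in>S. f x y \<in> S)"
proof -
  have Cinf: "Cinfinite |U|"
    using U by (simp add: cinfinite_def Field_card_of card_of_card_order_on)
  define step where "step T = T \<union> (\<Union>f\<in>Ops. \<Union>x\<in>T. f x ` T)" for T
  define T where "T n = (step ^^ n) X" for n
  have T_Suc: "T (Suc n) = step (T n)" and T_0: "T 0 = X" for n
    by (simp_all add: T_def)
  have bound: "|T n| \<le>o |U|" for n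
  proof (induction n)
    case 0
    show ?case using X by (simp add: T_0)
  next
    case (Suc n)
    have "|f x ` T n| \<le>o |U|" for f x
      using Suc card_of_image ordLeq_transitive by blast
    then have "|\<Union>f\<in>Ops. \<Union>x\<in>T n. f x ` T n| \<le>o |U|"
      by (intro card_of_UNION_ordLeq_infinite U Ops Suc ballI)
    then show ?case
      unfolding T_Suc step_def by (intro Un_Cinfinite_bound Cinf Suc)
  qed
  have sub: "T n \<subseteq> C" for n
  proof (induction n)
    case 0
    show ?case using XC by (simp add: T_0)
  next
    case (Suc n)
    then show ?case using C by (fastforce simp: T_Suc step_def)
  qed
  have mono: "T m \<subseteq> T n" if "m \<le> n" for m n
    by (rule lift_Suc_mono_le[OF _ that]) (auto simp: T_Suc step_def)
  show ?thesis
  proof (intro exI[of _ "\<Union>n. T n"] conjI ballI)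
    show "X \<subseteq> (\<Union>n. T n)"
      using T_0 by blast
    show "(\<Union>n. T n) \<subseteq> C"
      using sub by blast
    have "|UNIV :: nat set| \<le>o |U|"
      using U infinite_iff_card_of_nat by blast
    then show "|\<Union>n. T n| \<le>o |U|"
      by (intro card_of_UNION_ordLeq_infinite U ballI bound)
  next
    fix f x y
    assume f: "f \<in> Ops" and "x \<in> (\<Union>n. T n)" "y \<in> (\<Union>n. T n)"
    then obtain i j where "x \<in> T i" "y \<in> T j" by blast
    \<comment> \<open>The two arguments may enter at different rounds; both are present at the later
      one, and their value is adjoined one round after that.\<close>
    then have "x \<in> T (max i j)" "y \<in> T (max i j)"
      using mono[of i "max i j"] mono[of j "max i j"] by auto
    then have "f x y \<in> T (Suc (max i j))"
      using f by (auto simp: T_Suc step_def)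
    then show "f x y \<in> (\<Union>n. T n)" by blast
  qed
qed

section \<open>Size of the field and subalgebras\<close>

context diassociative_algebra
begin

lemma lprod_closed: "\<lbrakk>x \<in> carrier K; y \<in> carrier K\<rbrakk> \<Longrightarrow> x \<stileturn>\<^bsub>K\<^esub> y \<in> carrier K"
  and rprod_closed: "\<lbrakk>x \<in> carrier K; y \<in> carrier K\<rbrakk> \<Longrightarrow> x \<turnstile>\<^bsub>K\<^esub> y \<in> carrier K"
  using lprod_bilinear rprod_bilinear by (auto simp: bilinear_op_def)

text \<open>For a fixed nonzero \<open>x\<close>, scaling \<open>x\<close> is injective in the
  scalar: if \<open>c\<close> and \<open>d\<close> agree on \<open>x\<close> but differ, their
  difference is a unit of \<open>F\<close> that kills \<open>x\<close>, and multiplying by its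
  inverse gives \<open>x\<close> = 0.\<close>

lemma card_field_le_carrier:
  includes cardinal_syntax
  assumes "carrier K \<noteq> {\<zero>\<^bsub>K\<^esub>}"
  shows "|carrier F| \<le>o |carrier K|"
proof -
  obtain x where x: "x \<in> carrier K" "x \<noteq> \<zero>\<^bsub>K\<^esub>"
    using assms M.zero_closed by blast
  have "inj_on (\<lambda>c. c \<odot>\<^bsub>K\<^esub> x) (carrier F)"
  proof (rule inj_onI)
    fix c d
    assume c: "c \<in> carrier F" and d: "d \<in> carrier F" and eq: "c \<odot>\<^bsub>K\<^esub> x = d \<odot>\<^bsub>K\<^esub> x"
    show "c = d"
    proof (rule ccontr)
      assume "c \<noteq> d"
      have "c \<ominus> d \<noteq> \<zero>"
      proof
        assume "c \<ominus> d = \<zero>"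
        then have "\<ominus> (\<ominus> d) = c"
          using c d by (metis a_minus_def abelian_group.a_inv_closed abelian_group.minus_equality
              is_abelian_group)
        then show False
          using d \<open>c \<noteq> d\<close> by (simp add: abelian_group.minus_minus[OF is_abelian_group])
      qed
      then have unit: "c \<ominus> d \<in> Units F"
        using c d by (simp add: field_Units)
      have "(c \<ominus> d) \<odot>\<^bsub>K\<^esub> x = \<zero>\<^bsub>K\<^esub>"
        unfolding a_minus_def
        using c d x eq by (simp add: smult_l_distr smult_l_minus M.r_neg)
      moreover have "inv (c \<ominus> d) \<odot>\<^bsub>K\<^esub> ((c \<ominus> d) \<odot>\<^bsub>K\<^esub> x) = x"
        using unit x Units_inv_closed[OF unit] Units_closed[OF unit]
        by (simp add: smult_assoc1[symmetric])
      ultimately show False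
        using x Units_inv_closed[OF unit] by simp
    qed
  qed
  moreover have "(\<lambda>c. c \<odot>\<^bsub>K\<^esub> x) ` carrier F \<subseteq> carrier K"
    using x by auto
  ultimately show ?thesis
    using card_of_ordLeq by blast
qed

text \<open>Zero and negatives are obtained from the scalars 0 and -1. Apart from nonemptiness,
  being a subalgebra is thus closure under operations that can all be read as binary ones.\<close>

definition subalgebra_set :: "'a set \<Rightarrow> bool"
  where "subalgebra_set S \<longleftrightarrow> S \<subseteq> carrier K \<and> S \<noteq> {} \<and>
    (\<forall>x\<in>S. \<forall>y\<in>S. x \<oplus>\<^bsub>K\<^esub> y \<in> S \<and> x \<stileturn>\<^bsub>K\<^esub> y \<in> S \<and> x \<turnstile>\<^bsub>K\<^esub> y \<in> S) \<and>
    (\<forall>c\<in>carrier F. \<forall>x\<in>S. c \<odot>\<^bsub>K\<^esub> x \<in> S)"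

lemma subalgebra_set_zero:
  assumes "subalgebra_set S"
  shows "\<zero>\<^bsub>K\<^esub> \<in> S"
proof -
  obtain x where "x \<in> S" "x \<in> carrier K"
    using assms by (auto simp: subalgebra_set_def)
  moreover have "\<zero> \<in> carrier F"
    by simp
  ultimately have "\<zero> \<odot>\<^bsub>K\<^esub> x \<in> S"
    using assms by (auto simp only: subalgebra_set_def)
  then show ?thesis
    using \<open>x \<in> carrier K\<close> by simp
qed

lemma subalgebra_set_minus:
  assumes "subalgebra_set S" "x \<in> S"
  shows "\<ominus>\<^bsub>K\<^esub> x \<in> S"
proof -
  have x: "x \<in> carrier K"
    using assms by (auto simp: subalgebra_set_def)
  have "(\<ominus> \<one>) \<odot>\<^bsub>K\<^esub> x \<in> S"
    using assms by (auto simp: subalgebra_set_def)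
  then show ?thesis
    using x by (simp add: smult_l_minus)
qed

end

section \<open>Transport of structure along an injection\<close>

definition transport_dialg ::
  "('f, 'e, 'm) dialg_scheme \<Rightarrow> 'e set \<Rightarrow> ('e \<Rightarrow> 'b) \<Rightarrow> ('f, 'b) dialg"
  where "transport_dialg E S g =
    \<lparr>carrier = g ` S,
     mult = undefined, one = undefined,
     zero = g \<zero>\<^bsub>E\<^esub>,
     add = (\<lambda>u v. g (inv_into S g u \<oplus>\<^bsub>E\<^esub> inv_into S g v)),
     smult = (\<lambda>c u. g (c \<odot>\<^bsub>E\<^esub> inv_into S g u)),
     lprod = (\<lambda>u v. g (inv_into S g u \<stileturn>\<^bsub>E\<^esub> inv_into S g v)),
     rprod = (\<lambda>u v. g (inv_into S g u \<turnstile>\<^bsub>E\<^esub> inv_into S g v))\<rparr>"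

lemma transport_dialg_simps:
  assumes "inj_on g S"
  shows "carrier (transport_dialg E S g) = g ` S"
    and "\<zero>\<^bsub>transport_dialg E S g\<^esub> = g \<zero>\<^bsub>E\<^esub>"
    and "\<lbrakk>x \<in> S; y \<in> S\<rbrakk> \<Longrightarrow> g x \<oplus>\<^bsub>transport_dialg E S g\<^esub> g y = g (x \<oplus>\<^bsub>E\<^esub> y)"
    and "\<lbrakk>x \<in> S; y \<in> S\<rbrakk> \<Longrightarrow> g x \<stileturn>\<^bsub>transport_dialg E S g\<^esub> g y = g (x \<stileturn>\<^bsub>E\<^esub> y)"
    and "\<lbrakk>x \<in> S; y \<in> S\<rbrakk> \<Longrightarrow> g x \<turnstile>\<^bsub>transport_dialg E S g\<^esub> g y = g (x \<turnstile>\<^bsub>E\<^esub> y)"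
    and "x \<in> S \<Longrightarrow> c \<odot>\<^bsub>transport_dialg E S g\<^esub> g x = g (c \<odot>\<^bsub>E\<^esub> x)"
  using assms by (simp_all add: transport_dialg_def)

lemma (in diassociative_algebra) transport_diassociative:
  assumes S: "subalgebra_set S" and g: "inj_on g S"
  shows "diassociative_algebra F (transport_dialg K S g)"
proof -
  note simps = transport_dialg_simps[OF g]
  have mem: "x \<in> S \<Longrightarrow> x \<in> carrier K" for x
    using S by (auto simp: subalgebra_set_def)
  have closed: "x \<in> S \<Longrightarrow> y \<in> S \<Longrightarrow> x \<oplus>\<^bsub>K\<^esub> y \<in> S" "x \<in> S \<Longrightarrow> y \<in> S \<Longrightarrow> x \<stileturn>\<^bsub>K\<^esub> y \<in> S"
    "x \<in> S \<Longrightarrow> y \<in> S \<Longrightarrow> x \<turnstile>\<^bsub>K\<^esub> y \<in> S" "c \<in> carrier F \<Longrightarrow> x \<in> S \<Longrightarrow> c \<odot>\<^bsub>K\<^esub> x \<in> S" for x y c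
    using S by (auto simp: subalgebra_set_def)
  note zero = subalgebra_set_zero[OF S]
  \<comment> \<open>Bilinearity is checked once for an arbitrary operation \<open>p\<close> and its
    transported form \<open>p'\<close>, then instantiated with each of the two products.\<close>
  have bil: "bilinear_op F (transport_dialg K S g) p'"
    if p: "bilinear_op F K p" and pS: "\<And>x y. x \<in> S \<Longrightarrow> y \<in> S \<Longrightarrow> p x y \<in> S"
      and p': "\<And>x y. x \<in> S \<Longrightarrow> y \<in> S \<Longrightarrow> p' (g x) (g y) = g (p x y)" for p p'
    unfolding bilinear_op_def simps
    using p by (auto simp: simps closed p' pS bilinear_op_def mem)
  show ?thesis
  proof (intro diassociative_algebra.intro diassociative_algebra_axioms.intro module.intro
      module_axioms.intro abelian_groupI field_axioms is_cring)
    show "bilinear_op F (transport_dialg K S g) (lprod (transport_dialg K S g))"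
      by (rule bil[OF lprod_bilinear]) (simp_all add: closed simps)
    show "bilinear_op F (transport_dialg K S g) (rprod (transport_dialg K S g))"
      by (rule bil[OF rprod_bilinear]) (simp_all add: closed simps)
  next
    fix u
    assume "u \<in> carrier (transport_dialg K S g)"
    then obtain x where x: "u = g x" "x \<in> S"
      by (auto simp: simps)
    then have "g (\<ominus>\<^bsub>K\<^esub> x) \<oplus>\<^bsub>transport_dialg K S g\<^esub> u = \<zero>\<^bsub>transport_dialg K S g\<^esub>"
      by (simp add: simps subalgebra_set_minus[OF S] mem M.l_neg)
    then show "\<exists>v\<in>carrier (transport_dialg K S g).
        v \<oplus>\<^bsub>transport_dialg K S g\<^esub> u = \<zero>\<^bsub>transport_dialg K S g\<^esub>"
      using x subalgebra_set_minus[OF S] by (auto simp: simps)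
  next
    fix u v
    assume "u \<in> carrier (transport_dialg K S g)" "v \<in> carrier (transport_dialg K S g)"
    then show "u \<oplus>\<^bsub>transport_dialg K S g\<^esub> v = v \<oplus>\<^bsub>transport_dialg K S g\<^esub> u"
      by (auto simp: simps mem M.a_comm)
  \<comment> \<open>Every remaining element has the form \<open>g x\<close>, which reduces each law
    to the same law in \<open>K\<close>. The equation \<open>lprod_lprod\<close> is reversed so that
    the right-nested \<open>lprod\<close> is the normal form, as in
    \<open>lprod_assoc\<close>.\<close>
  qed (auto simp: simps closed zero mem M.a_assoc smult_l_distr smult_r_distr
      smult_assoc1 lprod_assoc rprod_assoc lprod_lprod[symmetric] rprod_lprod rprod_rprod)
qed

text \<open>The map stays onto because \<open>S\<close> already meets every fibre. A kernel element
  of the copy is \<open>g x\<close> with \<open>x\<close> in the kernel of \<open>w\<close>, so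
  \<open>x\<close> annihilates all of \<open>E\<close> and in particular \<open>S\<close>.\<close>

lemma central_extension_transport:
  fixes g :: "'e \<Rightarrow> 'b"
  assumes ext: "central_extension F E w L"
    and S: "diassociative_algebra.subalgebra_set F E S"
    and onto: "w ` S = carrier L" and g: "inj_on g S"
  shows "central_extension F (transport_dialg E S g) (w \<circ> inv_into S g) L"
proof -
  interpret E: diassociative_algebra F E
    using ext by (simp add: central_extension_def)
  note simps = transport_dialg_simps[OF g]
  have mem: "x \<in> S \<Longrightarrow> x \<in> carrier E" for x
    using S by (auto simp: E.subalgebra_set_def)
  have w: "w \<in> dialg_hom F E L" and ker: "a_kernel E L w \<subseteq> dialg_center E"
    using ext by (simp_all add: central_extension_def)
  have closed: "x \<in> S \<Longrightarrow> y \<in> S \<Longrightarrow> x \<oplus>\<^bsub>E\<^esub> y \<in> S" "x \<in> S \<Longrightarrow> y \<in> S \<Longrightarrow> x \<stileturn>\<^bsub>E\<^esub> y \<in> S"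
    "x \<in> S \<Longrightarrow> y \<in> S \<Longrightarrow> x \<turnstile>\<^bsub>E\<^esub> y \<in> S" "c \<in> carrier F \<Longrightarrow> x \<in> S \<Longrightarrow> c \<odot>\<^bsub>E\<^esub> x \<in> S" for x y c
    using S by (auto simp: E.subalgebra_set_def)
  have "w \<circ> inv_into S g \<in> dialg_hom F (transport_dialg E S g) L"
    using w by (auto simp: dialg_hom_def simps closed g mem)
  moreover have "(w \<circ> inv_into S g) ` carrier (transport_dialg E S g) = carrier L"
    using onto g by (simp add: simps image_comp[symmetric] image_image)
  moreover have "a_kernel (transport_dialg E S g) L (w \<circ> inv_into S g)
      \<subseteq> dialg_center (transport_dialg E S g)"
  proof
    fix u
    assume "u \<in> a_kernel (transport_dialg E S g) L (w \<circ> inv_into S g)"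
    then obtain x where x: "u = g x" "x \<in> S" "w x = \<zero>\<^bsub>L\<^esub>"
      using g by (auto simp: a_kernel_def' simps)
    then have "x \<in> dialg_center E"
      using ker mem by (auto simp: a_kernel_def')
    then show "u \<in> dialg_center (transport_dialg E S g)"
      using x by (auto simp: dialg_center_def simps mem)
  qed
  ultimately show ?thesis
    using ext E.transport_diassociative[OF S g] by (simp add: central_extension_def)
qed

section \<open>Centers in a central extension\<close>

text \<open>By surjectivity every element of \<open>L\<close> is some \<open>w x\<close>, and its
  products with \<open>w z\<close> are the images of the products of \<open>x\<close> and
  \<open>z\<close>, which vanish for central \<open>z\<close>.\<close>

lemma central_extension_image_center_subset:
  assumes "central_extension F E w L"
  shows "w ` dialg_center E \<subseteq> dialg_center L"
proof -
  have w: "w \<in> dialg_hom F E L" and onto: "w ` carrier E = carrier L"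
    using assms by (simp_all add: central_extension_def)
  interpret E: diassociative_algebra F E
    using assms by (simp add: central_extension_def)
  interpret L: diassociative_algebra F L
    using assms by (simp add: central_extension_def)
  have "\<zero>\<^bsub>F\<^esub> \<in> carrier F"
    by simp
  \<comment> \<open>Preservation of zero is not a clause of \<open>dialg_hom\<close>; it follows
    from compatibility with the scalar 0.\<close>
  then have "w (\<zero>\<^bsub>F\<^esub> \<odot>\<^bsub>E\<^esub> \<zero>\<^bsub>E\<^esub>) = \<zero>\<^bsub>F\<^esub> \<odot>\<^bsub>L\<^esub> w \<zero>\<^bsub>E\<^esub>" "w \<zero>\<^bsub>E\<^esub> \<in> carrier L"
    using w unfolding dialg_hom_def using E.M.zero_closed by blast+
  then have w0: "w \<zero>\<^bsub>E\<^esub> = \<zero>\<^bsub>L\<^esub>"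
    by simp
  show ?thesis
  proof
    fix u
    assume "u \<in> w ` dialg_center E"
    then obtain z where z: "u = w z" "z \<in> dialg_center E"
      by blast
    have zE: "z \<in> carrier E"
      using z by (simp add: dialg_center_def)
    have "u \<stileturn>\<^bsub>L\<^esub> y = \<zero>\<^bsub>L\<^esub> \<and> y \<stileturn>\<^bsub>L\<^esub> u = \<zero>\<^bsub>L\<^esub> \<and> u \<turnstile>\<^bsub>L\<^esub> y = \<zero>\<^bsub>L\<^esub> \<and> y \<turnstile>\<^bsub>L\<^esub> u = \<zero>\<^bsub>L\<^esub>"
      if "y \<in> carrier L" for y
    proof -
      obtain x where x: "y = w x" "x \<in> carrier E"
        using \<open>y \<in> carrier L\<close> onto by blast
      have "w (z \<stileturn>\<^bsub>E\<^esub> x) = u \<stileturn>\<^bsub>L\<^esub> y" "w (x \<stileturn>\<^bsub>E\<^esub> z) = y \<stileturn>\<^bsub>L\<^esub> u"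
        "w (z \<turnstile>\<^bsub>E\<^esub> x) = u \<turnstile>\<^bsub>L\<^esub> y" "w (x \<turnstile>\<^bsub>E\<^esub> z) = y \<turnstile>\<^bsub>L\<^esub> u"
        using w x z zE by (auto simp: dialg_hom_def)
      then show ?thesis
        using x z w0 by (auto simp: dialg_center_def)
    qed
    moreover have "u \<in> carrier L"
      using zE z onto by blast
    ultimately show "u \<in> dialg_center L"
      by (simp add: dialg_center_def)
  qed
qed

text \<open>Each element of \<open>E\<close> is an element of \<open>S\<close> plus an element of
  the kernel. The kernel is central, so annihilating \<open>S\<close> on both sides already means
  annihilating \<open>E\<close>.\<close>

lemma central_extension_center_of_preimages:
  assumes ext: "central_extension F E w L"
    and S: "S \<subseteq> carrier E" "w ` S = carrier L"
    and z: "z \<in> carrier E" and comm: "\<And>x. x \<in> S \<Longrightarrow>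
      z \<stileturn>\<^bsub>E\<^esub> x = \<zero>\<^bsub>E\<^esub> \<and> x \<stileturn>\<^bsub>E\<^esub> z = \<zero>\<^bsub>E\<^esub> \<and> z \<turnstile>\<^bsub>E\<^esub> x = \<zero>\<^bsub>E\<^esub> \<and> x \<turnstile>\<^bsub>E\<^esub> z = \<zero>\<^bsub>E\<^esub>"
  shows "z \<in> dialg_center E"
proof -
  interpret E: diassociative_algebra F E
    using ext by (simp add: central_extension_def)
  interpret L: diassociative_algebra F L
    using ext by (simp add: central_extension_def)
  have w: "w \<in> dialg_hom F E L" and ker: "a_kernel E L w \<subseteq> dialg_center E"
    using ext by (simp_all add: central_extension_def)
  have "z \<stileturn>\<^bsub>E\<^esub> y = \<zero>\<^bsub>E\<^esub> \<and> y \<stileturn>\<^bsub>E\<^esub> z = \<zero>\<^bsub>E\<^esub> \<and> z \<turnstile>\<^bsub>E\<^esub> y = \<zero>\<^bsub>E\<^esub> \<and> y \<turnstile>\<^bsub>E\<^esub> z = \<zero>\<^bsub>E\<^esub>"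
    if y: "y \<in> carrier E" for y
  proof -
    have "w y \<in> carrier L"
      using w y by (auto simp: dialg_hom_def)
    then obtain x where x: "x \<in> S" "w x = w y"
      using S by (metis imageE)
    have xE: "x \<in> carrier E"
      using x S by blast
    \<comment> \<open>This is the difference of \<open>y\<close> and \<open>x\<close>, written with
      the scalar -1 so that the sum and scalar clauses of \<open>dialg_hom\<close> compute its image
      directly.\<close>
    define k where "k = y \<oplus>\<^bsub>E\<^esub> (\<ominus>\<^bsub>F\<^esub> \<one>\<^bsub>F\<^esub>) \<odot>\<^bsub>E\<^esub> x"
    have k: "k \<in> carrier E"
      using xE y by (simp add: k_def)
    have "w k = w y \<oplus>\<^bsub>L\<^esub> (\<ominus>\<^bsub>F\<^esub> \<one>\<^bsub>F\<^esub>) \<odot>\<^bsub>L\<^esub> w x"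
      using w y xE by (simp add: k_def dialg_hom_def)
    then have "w k = \<zero>\<^bsub>L\<^esub>"
      using x \<open>w y \<in> carrier L\<close> by (simp add: L.smult_l_minus L.M.r_neg)
    then have "k \<in> dialg_center E"
      using k ker by (auto simp: a_kernel_def')
    moreover have "y = x \<oplus>\<^bsub>E\<^esub> k"
      using xE y by (simp add: k_def E.smult_l_minus E.M.a_comm[of y] E.M.a_assoc[symmetric] E.M.r_neg)
    ultimately show ?thesis
      using E.lprod_bilinear E.rprod_bilinear xE k z comm[OF x(1)]
      by (simp add: bilinear_op_def dialg_center_def)
  qed
  then show ?thesis
    using z by (simp add: dialg_center_def)
qed

section \<open>Reduction to extensions carried by lists\<close>

text \<open>\<open>S\<close> is the closure of one chosen preimage of each element of
  \<open>L\<close>. Since \<open>L\<close> is nonzero, \<open>F\<close> is no larger than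
  \<open>L\<close>, so there are at most as many generators and operations as lists over
  \<open>'a\<close>, and the closure respects this bound.\<close>

lemma central_extension_small_subalgebra:
  fixes L :: "('f, 'a, 'l) dialg_scheme" and E :: "('f, 'e, 'm) dialg_scheme"
  assumes ext: "central_extension F E w L" and L: "carrier L \<noteq> {\<zero>\<^bsub>L\<^esub>}"
  obtains S and g :: "'e \<Rightarrow> 'a list" where
    "diassociative_algebra.subalgebra_set F E S" "w ` S = carrier L" "inj_on g S"
proof -
  include cardinal_syntax
  interpret E: diassociative_algebra F E
    using ext by (simp add: central_extension_def)
  interpret L: diassociative_algebra F L
    using ext by (simp add: central_extension_def)
  have w: "w \<in> dialg_hom F E L" and onto: "w ` carrier E = carrier L"
    using ext by (simp_all add: central_extension_def)
  define X where "X = inv_into (carrier E) w ` carrier L"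
  \<comment> \<open>Each scalar contributes one operation that ignores its second argument, which
    makes scaling fit the binary format.\<close>
  define Ops where "Ops = {add E, lprod E, rprod E} \<union> (\<lambda>c x y. c \<odot>\<^bsub>E\<^esub> x) ` carrier F"
  \<comment> \<open>Lists form an infinite type even when \<open>'a\<close> is finite, and they
    contain \<open>L\<close> as singletons.\<close>
  let ?U = "UNIV :: 'a list set"
  have inf: "infinite ?U"
    by (rule infinite_UNIV_listI)
  then have Cinf: "Cinfinite |?U|"
    by (simp add: cinfinite_def Field_card_of card_of_card_order_on)
  have "inj_on (\<lambda>x. [x]) (carrier L)"
    by (simp add: inj_on_def)
  then have LU: "|carrier L| \<le>o |?U|"
    using card_of_ordLeq by blast
  have X: "|X| \<le>o |?U|"
    using LU card_of_image ordLeq_transitive unfolding X_def by blast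
  have "|carrier F| \<le>o |?U|"
    using L.card_field_le_carrier[OF L] LU ordLeq_transitive by blast
  then have "|(\<lambda>c x y. c \<odot>\<^bsub>E\<^esub> x) ` carrier F| \<le>o |?U|"
    using card_of_image ordLeq_transitive by blast
  moreover have "|{add E, lprod E, rprod E}| \<le>o |?U|"
    by (rule ordLess_imp_ordLeq, rule finite_ordLess_infinite)
      (simp_all only: card_of_well_order_on Field_card_of inf finite.intros not_False_eq_True)
  ultimately have Ops: "|Ops| \<le>o |?U|"
    unfolding Ops_def by (intro Un_Cinfinite_bound Cinf)
  have XE: "X \<subseteq> carrier E"
    using onto by (auto simp: X_def intro: inv_into_into)
  have closed: "\<forall>f\<in>Ops. \<forall>x\<in>carrier E. \<forall>y\<in>carrier E. f x y \<in> carrier E"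
    by (auto simp: Ops_def E.lprod_closed E.rprod_closed)
  obtain S where S: "X \<subseteq> S" "S \<subseteq> carrier E" "|S| \<le>o |?U|"
    and S_closed: "\<forall>f\<in>Ops. \<forall>x\<in>S. \<forall>y\<in>S. f x y \<in> S"
    using bounded_closure_exists[OF inf X Ops XE closed] by blast
  obtain g :: "'e \<Rightarrow> 'a list" where "inj_on g S"
    using S(3) unfolding card_of_ordLeq[symmetric] by blast
  moreover have "w ` S = carrier L"
  proof
    show "w ` S \<subseteq> carrier L"
      using S(2) onto by blast
    have "w ` X = carrier L"
      using onto by (simp add: X_def image_image f_inv_into_f)
    then show "carrier L \<subseteq> w ` S"
      using S(1) by blast
  qed
  moreover have "E.subalgebra_set S"
    unfolding E.subalgebra_set_def
  proof (intro conjI ballI)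
    show "S \<noteq> {}"
      using S(1) L.M.zero_closed by (auto simp: X_def)
  next
    fix c x
    assume "c \<in> carrier F" "x \<in> S"
    then show "c \<odot>\<^bsub>E\<^esub> x \<in> S"
      using S_closed by (auto simp: Ops_def)
  qed (use S(2) S_closed in \<open>auto simp: Ops_def\<close>)
  ultimately show ?thesis
    using that by blast
qed

text \<open>The list copy of a small subalgebra \<open>S\<close> is one of the extensions
  intersected in \<open>Zstar\<close>, so \<open>a\<close> is the image of some \<open>z\<close>
  central in \<open>S\<close>. As \<open>S\<close> maps onto \<open>L\<close>, this \<open>z\<close>
  is central in \<open>E\<close> as well.\<close>

lemma Zstar_subset_image_center:
  fixes L :: "('f, 'a, 'l) dialg_scheme" and E :: "('f, 'e, 'm) dialg_scheme"
  assumes ext: "central_extension F E w L" and L: "carrier L \<noteq> {\<zero>\<^bsub>L\<^esub>}"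
  shows "Zstar F L \<subseteq> w ` dialg_center E"
proof
  fix a
  assume a: "a \<in> Zstar F L"
  interpret E: diassociative_algebra F E
    using ext by (simp add: central_extension_def)
  obtain S and g :: "'e \<Rightarrow> 'a list" where
    S: "E.subalgebra_set S" and onto: "w ` S = carrier L" and g: "inj_on g S"
    using central_extension_small_subalgebra[OF ext L] .
  note simps = transport_dialg_simps[OF g]
  have SE: "S \<subseteq> carrier E"
    using S by (simp add: E.subalgebra_set_def)
  have "a \<in> (w \<circ> inv_into S g) ` dialg_center (transport_dialg E S g)"
    using a central_extension_transport[OF ext S onto g] unfolding Zstar_def by blast
  then obtain z where z: "z \<in> S" "a = w z" "g z \<in> dialg_center (transport_dialg E S g)"
    using g by (auto simp: dialg_center_def simps)
  have "z \<in> dialg_center E"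
  proof (rule central_extension_center_of_preimages[OF ext SE onto])
    show "z \<in> carrier E"
      using z SE by blast
  next
    fix x
    assume x: "x \<in> S"
    have "g (z \<stileturn>\<^bsub>E\<^esub> x) = g \<zero>\<^bsub>E\<^esub>" "g (x \<stileturn>\<^bsub>E\<^esub> z) = g \<zero>\<^bsub>E\<^esub>"
      "g (z \<turnstile>\<^bsub>E\<^esub> x) = g \<zero>\<^bsub>E\<^esub>" "g (x \<turnstile>\<^bsub>E\<^esub> z) = g \<zero>\<^bsub>E\<^esub>"
      using z x by (auto simp: dialg_center_def simps)
    \<comment> \<open>Both sides of the four equations are images of elements of \<open>S\<close>,
      so injectivity of \<open>g\<close> on \<open>S\<close> removes \<open>g\<close>.\<close>
    then show "z \<stileturn>\<^bsub>E\<^esub> x = \<zero>\<^bsub>E\<^esub> \<and> x \<stileturn>\<^bsub>E\<^esub> z = \<zero>\<^bsub>E\<^esub> \<and> z \<turnstile>\<^bsub>E\<^esub> x = \<zero>\<^bsub>E\<^esub> \<and> x \<turnstile>\<^bsub>E\<^esub> z = \<zero>\<^bsub>E\<^esub>"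
      using S z(1) x E.subalgebra_set_zero[OF S] inj_onD[OF g]
      by (simp add: E.subalgebra_set_def)
  qed
  then show "a \<in> w ` dialg_center E"
    using z by blast
qed

theorem theorem4p10:
  fixes F :: "('f, 'r) ring_scheme"
    and L :: "('f, 'a, 'l) dialg_scheme"
  assumes "diassociative_algebra F L"
    and "dialg_center L \<subseteq> Zstar F L"
  shows "\<And>(E :: ('f, 'e, 'm) dialg_scheme) \<omega>.
    stem_extension F E \<omega> L \<Longrightarrow> \<omega> ` dialg_center E = dialg_center L"
proof -
  fix E :: "('f, 'e, 'm) dialg_scheme" and \<omega>
  assume "stem_extension F E \<omega> L"
  then have ext: "central_extension F E \<omega> L"
    by (simp add: stem_extension_def)
  have "dialg_center L \<subseteq> \<omega> ` dialg_center E"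
  proof (cases "carrier L = {\<zero>\<^bsub>L\<^esub>}")
    \<comment> \<open>For \<open>L\<close> = 0 the embedding of \<open>F\<close> into
      \<open>L\<close> fails, so this case is settled directly: the zero of \<open>E\<close> can
      only map to zero, hence it lies in the kernel and is central.\<close>
    case True
    interpret E: diassociative_algebra F E
      using ext by (simp add: central_extension_def)
    have "\<omega> \<zero>\<^bsub>E\<^esub> = \<zero>\<^bsub>L\<^esub>"
      using ext True by (auto simp: central_extension_def dialg_hom_def)
    then have "\<zero>\<^bsub>E\<^esub> \<in> dialg_center E"
      using ext by (auto simp: central_extension_def a_kernel_def')
    then have "\<zero>\<^bsub>L\<^esub> \<in> \<omega> ` dialg_center E"
      using \<open>\<omega> \<zero>\<^bsub>E\<^esub> = \<zero>\<^bsub>L\<^esub>\<close> by (metis imageI)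
    then show ?thesis
      using True by (auto simp: dialg_center_def)
  next
    case False
    then show ?thesis
      using assms(2) Zstar_subset_image_center[OF ext] by blast
  qed
  then show "\<omega> ` dialg_center E = dialg_center L"
    using central_extension_image_center_subset[OF ext] by blast
qed

end
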